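(* Let $X:\mathbb{S}^1\to\mathbb{R}^2$ be a parametrization of a closed simple curve $\Gamma_X$ with $X\in C^2(\mathbb{S}^1)$, and assume there exist constants $0<C_1<C_2$ such that $C_1\le|\partial_\xi X(\xi)|\le C_2$ for all $\xi\in\mathbb{S}^1$. Then there exist positive constants $\delta_0$ and $C$, depending on $X$, $C_1$ and $C_2$, such that for any parametrization $Y\in C^0(\mathbb{S}^1)$ of a closed simple curve $\Gamma_Y$ satisfying $\|X-Y\|_{L^\infty}\le\delta_0$, the following inequality holds: $$\mathrm{M}(\Gamma_X,\Gamma_Y)\le C\|X-Y\|_{L^\infty},$$ where $\Gamma_X$ and $\Gamma_Y$ are the images of $X$ and $Y$, respectively.
   Context: $\mathbb{S}^1=[0,2\pi]$ with endpoints identified (functions on it are $2\pi$-periodic). For two closed simple curves $\Gamma_1,\Gamma_2$ in $\mathbb{R}^2$ enclosing the regions $\Omega_1,\Omega_2$, the manifold distance is $\mathrm{M}(\Gamma_1,\Gamma_2)=\mathrm{Area}\big((\Omega_1\setminus\Omega_2)\cup(\Omega_2\setminus\Omega_1)\big)=\mathrm{Area}(\Omega_1)+\mathrm{Area}(\Omega_2)-2\,\mathrm{Area}(\Omega_1\cap\Omega_2)$. *)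

theory Defs
  imports "HOL-Analysis.Analysis" "HOL-Probability.Essential_Supremum"
begin

text \<open>
  Functions on the circle, i.e. on \<open>[0, 2\<pi>]\<close> with endpoints identified, are represented as
  \<open>2\<pi>\<close>-periodic functions on the real line, so that regularity on the circle (including
  at the identified endpoint) is regularity on all of \<open>\<real>\<close>.
\<close>

definition circle_fun :: "(real \<Rightarrow> 'a) \<Rightarrow> bool"
  where "circle_fun f \<longleftrightarrow> (\<forall>\<xi>. f (\<xi> + 2 * pi) = f \<xi>)"

definition circle_C0 :: "(real \<Rightarrow> 'a::topological_space) \<Rightarrow> bool"
  where "circle_C0 f \<longleftrightarrow> circle_fun f \<and> continuous_on UNIV f"

definition circle_C2 :: "(real \<Rightarrow> 'a::real_normed_vector) \<Rightarrow> bool"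
  where "circle_C2 f \<longleftrightarrow> circle_fun f \<and> f C1_differentiable_on UNIV \<and>
           (\<lambda>\<xi>. vector_derivative f (at \<xi>)) C1_differentiable_on UNIV"

definition param_closed_simple_curve :: "(real \<Rightarrow> real^2) \<Rightarrow> bool"
  where "param_closed_simple_curve f \<longleftrightarrow> circle_C0 f \<and> inj_on f {0..<2*pi}"

definition curve_image :: "(real \<Rightarrow> 'a) \<Rightarrow> 'a set"
  where "curve_image f = f ` {0..2*pi}"

definition Linf_norm :: "(real \<Rightarrow> 'a::real_normed_vector) \<Rightarrow> ereal"
  where "Linf_norm f = esssup (lebesgue_on {0..2*pi}) (\<lambda>\<xi>. ereal (norm (f \<xi>)))"

text \<open>
  The region enclosed by a closed simple curve \<open>\<Gamma>\<close> is \<^term>\<open>inside \<Gamma>\<close>, the union of the bounded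
  components of its complement.
\<close>

definition manifold_distance :: "(real^2) set \<Rightarrow> (real^2) set \<Rightarrow> real"
  where "manifold_distance \<Gamma>\<^sub>1 \<Gamma>\<^sub>2 =
           measure lebesgue ((inside \<Gamma>\<^sub>1 - inside \<Gamma>\<^sub>2) \<union> (inside \<Gamma>\<^sub>2 - inside \<Gamma>\<^sub>1))"

end

theory Submission
  imports Defs
begin

text \<open>
  Let \<open>\<epsilon>\<close> be the supremum of \<open>|X - Y|\<close>. If a point \<open>p\<close> is at distance more than \<open>\<epsilon>\<close> from \<open>\<Gamma>\<^sub>X\<close>,
  then it avoids every segment from \<open>X \<xi>\<close> to \<open>Y \<xi>\<close>, so the maps
  \<open>\<xi> \<mapsto> (X \<xi> - p) / |X \<xi> - p|\<close> and \<open>\<xi> \<mapsto> (Y \<xi> - p) / |Y \<xi> - p|\<close> are homotopic. One is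
  null-homotopic if and only if the other is, so by Borsuk's separation criterion, transported along
  the homeomorphism \<open>X \<xi> \<mapsto> Y \<xi>\<close> of the two curves, \<open>p\<close> is enclosed by both curves or by
  neither. Hence the symmetric difference lies in the \<open>\<epsilon>\<close>-neighbourhood of \<open>\<Gamma>\<^sub>X\<close>. As \<open>X\<close> is
  Lipschitz, this neighbourhood is covered by \<open>O(1/\<epsilon>)\<close> discs of radius \<open>2\<epsilon>\<close>, so its area is
  \<open>O(\<epsilon>)\<close>.
\<close>

text \<open>By Borsuk's criterion, the component of \<open>p\<close> in the complement of a compact
  set is unbounded exactly when the radial projection \<open>?b\<close> from \<open>p\<close> is
  null-homotopic on that set. A null-homotopy on \<open>T\<close> pulls back along \<open>h\<close>,
  and sliding \<open>h\<close> back to the identity turns it into one on \<open>S\<close>.\<close>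

lemma inside_subset_inside_of_map:
  fixes h :: "'a::euclidean_space \<Rightarrow> 'a"
  assumes "compact S" "compact T" "continuous_on S h" "h \<in> S \<rightarrow> T"
    and seg: "\<And>x. x \<in> S \<Longrightarrow> p \<notin> closed_segment x (h x)"
    and "p \<notin> T" and p: "p \<in> inside S"
  shows "p \<in> inside T"
proof (rule ccontr)
  let ?b = "\<lambda>x. inverse (norm (x - p)) *\<^sub>R (x - p)"
  let ?H = "homotopic_with_canon (\<lambda>_. True)"
  have "p \<notin> S" and bounded: "bounded (connected_component_set (- S) p)"
    using p by (auto simp: inside_def)
  assume "p \<notin> inside T"
  then have "\<not> bounded (connected_component_set (- T) p)"
    using \<open>p \<notin> T\<close> by (simp add: inside_def)
  then obtain c where "?H T (sphere 0 1) ?b (\<lambda>x. c)"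
    using Borsuk_map_essential_bounded_component[OF \<open>compact T\<close> \<open>p \<notin> T\<close>] by blast
  then have "?H S (sphere 0 1) (?b \<circ> h) ((\<lambda>x. c) \<circ> h)"
    using assms by (intro homotopic_with_compose_continuous_right) auto
  \<comment> \<open>The straight-line homotopy from \<open>id\<close> to \<open>h\<close> stays off
    \<open>p\<close> by \<open>seg\<close>, so it can be followed by the radial projection.\<close>
  moreover have "?H S (sphere 0 1) (?b \<circ> id) (?b \<circ> h)"
  proof (rule homotopic_with_compose_continuous_left)
    show "?H S (- {p}) id h"
      using assms by (intro homotopic_with_linear) auto
    show "continuous_on (- {p}) ?b"
      by (rule continuous_on_Borsuk_map) auto
    show "?b \<in> - {p} \<rightarrow> sphere 0 1"
      by (simp add: Borsuk_map_into_sphere)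
  qed
  ultimately have "?H S (sphere 0 1) ?b (\<lambda>x. c)"
    by (auto simp: o_def intro: homotopic_with_trans)
  then show False
    using Borsuk_map_essential_bounded_component[OF \<open>compact S\<close> \<open>p \<notin> S\<close>] bounded by blast
qed

text \<open>A continuous map from a compact space onto a Hausdorff one is a quotient map, so a
  continuous \<open>g\<close> that is constant on the fibres of \<open>f\<close> descends to the
  image. This yields the map between two curves although the parameter interval has both endpoints
  over one point.\<close>

lemma continuous_factor_through_compact:
  fixes f :: "'a::t2_space \<Rightarrow> 'b::metric_space" and g :: "'a \<Rightarrow> 'c::topological_space"
  assumes "compact K" "continuous_on K f" "continuous_on K g"
    and fg: "\<And>x y. \<lbrakk>x \<in> K; y \<in> K; f x = f y\<rbrakk> \<Longrightarrow> g x = g y"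
  obtains h where "continuous_on (f ` K) h" "\<And>x. x \<in> K \<Longrightarrow> h (f x) = g x"
proof
  let ?h = "g \<circ> inv_into K f"
  show h: "?h (f x) = g x" if "x \<in> K" for x
    unfolding o_apply by (rule fg) (use that in \<open>auto simp: inv_into_into f_inv_into_f\<close>)
  have "quotient_map (top_of_set K) (top_of_set (f ` K)) f"
    using assms(1,2)
    by (intro T1_Spaces.continuous_imp_quotient_map)
      (simp_all add: compact_space_subtopology Hausdorff_space_subtopology continuous_map_in_subtopology)
  moreover have "continuous_map (top_of_set K) euclidean (?h \<circ> f)"
    using continuous_on_eq[OF assms(3), of "?h \<circ> f"] h by (metis continuous_map_iff_continuous o_apply)
  ultimately have "continuous_map (top_of_set (f ` K)) euclidean ?h"
    by (rule continuous_compose_quotient_map)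
  then show "continuous_on (f ` K) ?h"
    by simp
qed

lemma circle_fun_2pi: "circle_fun f \<Longrightarrow> f (2 * pi) = f 0"
  using circle_fun_def[of f] by (metis add_0)

lemma param_closed_simple_curve_eq_imp:
  assumes X: "param_closed_simple_curve X" and Y: "circle_fun Y"
    and xy: "x \<in> {0..2*pi}" "y \<in> {0..2*pi}" "X x = X y"
  shows "Y x = Y y"
proof -
  \<comment> \<open>Moving the endpoint \<open>2 * pi\<close> to \<open>0\<close> changes no value
    of \<open>X\<close> or \<open>Y\<close> and brings every parameter into the half-open interval
    on which \<open>X\<close> is injective.\<close>
  define r where "r t = (if t = 2 * pi then 0 else t)" for t
  have r: "r t \<in> {0..<2*pi}" if "t \<in> {0..2*pi}" for t
    using that by (auto simp: r_def)
  have "circle_fun X" "inj_on X {0..<2*pi}"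
    using X by (auto simp: param_closed_simple_curve_def circle_C0_def)
  then have "X (r t) = X t" "Y (r t) = Y t" for t
    using Y by (simp_all add: r_def circle_fun_2pi)
  moreover have "r x = r y"
    using \<open>inj_on X {0..<2*pi}\<close> by (rule inj_onD) (use r xy calculation in auto)
  ultimately show ?thesis
    by metis
qed

lemma inside_curve_subset_of_close:
  assumes X: "param_closed_simple_curve X" and Y: "circle_C0 Y"
    and seg: "\<And>\<xi>. \<xi> \<in> {0..2*pi} \<Longrightarrow> p \<notin> closed_segment (X \<xi>) (Y \<xi>)"
    and p: "p \<in> inside (curve_image X)"
  shows "p \<in> inside (curve_image Y)"
proof -
  have cont: "continuous_on {0..2*pi} X" "continuous_on {0..2*pi} Y"
    using X Y by (auto simp: param_closed_simple_curve_def circle_C0_def intro: continuous_on_subset)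
  obtain h where h: "continuous_on (X ` {0..2*pi}) h" "\<And>\<xi>. \<xi> \<in> {0..2*pi} \<Longrightarrow> h (X \<xi>) = Y \<xi>"
    using continuous_factor_through_compact[OF compact_Icc cont]
      param_closed_simple_curve_eq_imp[OF X] Y by (metis circle_C0_def)
  show ?thesis
    unfolding curve_image_def
  proof (rule inside_subset_inside_of_map[of "X ` {0..2*pi}" _ h])
    show "compact (X ` {0..2*pi})" "compact (Y ` {0..2*pi})"
      using cont by (auto intro: compact_continuous_image)
    show "p \<in> inside (X ` {0..2*pi})"
      using p by (simp add: curve_image_def)
    show "p \<notin> Y ` {0..2*pi}"
      using seg by force
  qed (use h seg in auto)
qed

lemma symmetric_difference_subset_neighbourhood:
  assumes X: "param_closed_simple_curve X" and Y: "param_closed_simple_curve Y"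
    and close: "\<And>\<xi>. \<xi> \<in> {0..2*pi} \<Longrightarrow> norm (X \<xi> - Y \<xi>) \<le> e"
  shows "(inside (curve_image X) - inside (curve_image Y))
           \<union> (inside (curve_image Y) - inside (curve_image X)) \<subseteq> (\<Union>\<xi>\<in>{0..2*pi}. cball (X \<xi>) e)"
proof -
  have C0: "circle_C0 X" "circle_C0 Y"
    using X Y by (auto simp: param_closed_simple_curve_def)
  have "p \<in> inside (curve_image X) \<longleftrightarrow> p \<in> inside (curve_image Y)"
    if p: "p \<notin> (\<Union>\<xi>\<in>{0..2*pi}. cball (X \<xi>) e)" for p
  proof -
    have "p \<notin> closed_segment (X \<xi>) (Y \<xi>)" if \<xi>: "\<xi> \<in> {0..2*pi}" for \<xi>
    proof -
      have "norm (X \<xi> - Y \<xi>) \<le> e" "0 \<le> e"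
        using close[OF \<xi>] norm_ge_zero order_trans by blast+
      then have "closed_segment (X \<xi>) (Y \<xi>) \<subseteq> cball (X \<xi>) e"
        by (intro closed_segment_subset) (auto simp: dist_norm)
      then show ?thesis
        using p \<xi> by blast
    qed
    \<comment> \<open>The segment is symmetric in its ends, so the one-sided result applies with the
      curves in either order.\<close>
    then show ?thesis
      using inside_curve_subset_of_close[OF X C0(2), of p] inside_curve_subset_of_close[OF Y C0(1), of p]
      by (auto simp: closed_segment_commute)
  qed
  then show ?thesis
    by blast
qed

text \<open>Sample parameters are spaced by \<open>e / L\<close>. The nearest sample to the left of
  a parameter is moved by \<open>X\<close> at most \<open>e\<close> away from its point, and the
  triangle inequality doubles the radius.\<close>

lemma lipschitz_tube_cover:
  fixes X :: "real \<Rightarrow> 'a::metric_space"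
  assumes "0 < L" "0 < e" and lip: "\<And>s t. dist (X s) (X t) \<le> L * \<bar>s - t\<bar>"
  shows "(\<Union>\<xi>\<in>{0..b}. cball (X \<xi>) e)
           \<subseteq> (\<Union>k\<in>{..nat \<lfloor>b * L / e\<rfloor>}. cball (X (real k * e / L)) (2 * e))"
proof clarify
  fix \<xi> p assume \<xi>: "\<xi> \<in> {0..b}" and p: "p \<in> cball (X \<xi>) e"
  define k where "k = nat \<lfloor>\<xi> * L / e\<rfloor>"
  have k: "real k \<le> \<xi> * L / e" "\<xi> * L / e < real k + 1"
    using \<xi> assms by (auto simp: k_def)
  have "k \<le> nat \<lfloor>b * L / e\<rfloor>"
    unfolding k_def using \<xi> assms
    by (intro nat_mono floor_mono divide_right_mono mult_right_mono) auto
  moreover have "p \<in> cball (X (real k * e / L)) (2 * e)"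
  proof -
    have "L * \<bar>real k * e / L - \<xi>\<bar> = \<bar>real k * e - \<xi> * L\<bar>"
      using \<open>0 < L\<close> by (simp add: abs_mult field_simps abs_if)
    also have "\<dots> \<le> e"
      using k \<open>0 < e\<close> by (auto simp: abs_le_iff field_simps)
    finally have "dist (X (real k * e / L)) (X \<xi>) \<le> e"
      using lip order_trans by blast
    then show ?thesis
      using p dist_triangle[of "X (real k * e / L)" p "X \<xi>"] by (simp add: dist_commute)
  qed
  ultimately show "p \<in> (\<Union>k\<in>{..nat \<lfloor>b * L / e\<rfloor>}. cball (X (real k * e / L)) (2 * e))"
    by blast
qed

lemma measure_lipschitz_tube_le:
  fixes X :: "real \<Rightarrow> real^2"
  assumes "0 < L" "0 < e" "0 \<le> b" and lip: "\<And>s t. dist (X s) (X t) \<le> L * \<bar>s - t\<bar>"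
    and A: "A \<in> sets lebesgue" "A \<subseteq> (\<Union>\<xi>\<in>{0..b}. cball (X \<xi>) e)"
  shows "measure lebesgue A \<le> 4 * pi * e * (b * L + e)"
proof -
  define N where "N = nat \<lfloor>b * L / e\<rfloor>"
  define B where "B k = cball (X (real k * e / L)) (2 * e)" for k
  have "A \<subseteq> (\<Union>k\<in>{..N}. B k)"
    using A(2) lipschitz_tube_cover[OF \<open>0 < L\<close> \<open>0 < e\<close> lip] unfolding N_def B_def by blast
  then have "measure lebesgue A \<le> measure lebesgue (\<Union>k\<in>{..N}. B k)"
    using A(1) by (intro measure_mono_fmeasurable fmeasurable.finite_UN) (auto simp: B_def)
  also have "\<dots> \<le> (\<Sum>k\<le>N. measure lebesgue (B k))"
    by (intro measure_UNION_le) (auto simp: B_def)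
  also have "\<dots> = (real N + 1) * (4 * pi * e\<^sup>2)"
    using \<open>0 < e\<close> by (simp add: B_def content_cball unit_ball_vol_2 power2_eq_square)
  \<comment> \<open>The sample at \<open>k = 0\<close> accounts for the extra \<open>1\<close>,
    which becomes the lower-order term \<open>e\<close> in the final bound.\<close>
  also have "\<dots> \<le> (b * L / e + 1) * (4 * pi * e\<^sup>2)"
    using assms(1-3) by (intro mult_right_mono add_right_mono) (auto simp: N_def)
  also have "\<dots> = 4 * pi * e * (b * L + e)"
    using \<open>0 < e\<close> by (simp add: field_simps power2_eq_square)
  finally show ?thesis .
qed

text \<open>The essential supremum bounds the norm only almost everywhere. By continuity the set
  where the bound holds is closed, so it contains the open interval, and then its endpoints by
  taking the closure.\<close>

lemma norm_le_Linf_norm: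
  fixes f :: "real \<Rightarrow> 'a::real_normed_vector"
  assumes cont: "continuous_on UNIV f" and \<xi>: "\<xi> \<in> {0..2*pi}"
  shows "ereal (norm (f \<xi>)) \<le> Linf_norm f"
proof -
  let ?C = "{x. ereal (norm (f x)) \<le> Linf_norm f}"
  have "?C = (\<lambda>x. ereal (norm (f x))) -` {..Linf_norm f}"
    by auto
  then have "closed ?C"
    using cont by (auto intro!: closed_vimage continuous_intros)
  have "AE x in lebesgue_on {0..2*pi}. x \<in> ?C"
    using esssup_AE[of "\<lambda>x. ereal (norm (f x))" "lebesgue_on {0..2*pi}"]
    by (simp add: Linf_norm_def)
  then have "AE x\<in>{0<..<2*pi} in lebesgue. x \<in> ?C"
    by (subst (asm) AE_restrict_space_iff) auto
  then have "{0<..<2*pi} \<subseteq> ?C"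
    using mem_closed_if_AE_lebesgue_open[OF open_greaterThanLessThan \<open>closed ?C\<close>] by blast
  then have "closure {0<..<2*pi} \<subseteq> ?C"
    using \<open>closed ?C\<close> by (rule closure_minimal)
  then show ?thesis
    using \<xi> by auto
qed

lemma C1_lipschitz:
  fixes f :: "real \<Rightarrow> 'a::real_normed_vector"
  assumes "f C1_differentiable_on UNIV" "\<And>x. norm (vector_derivative f (at x)) \<le> L"
  shows "dist (f s) (f t) \<le> L * \<bar>s - t\<bar>"
proof -
  have "(f has_derivative (\<lambda>h. h *\<^sub>R vector_derivative f (at x))) (at x)" for x
    using assms(1) by (simp add: C1_differentiable_on_eq vector_derivative_works
        flip: has_vector_derivative_def)
  moreover have "onorm (\<lambda>h::real. h *\<^sub>R vector_derivative f (at x)) \<le> L" for x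
    using assms(2) by (simp add: onorm_scaleR_left onorm_id)
  ultimately have "norm (f s - f t) \<le> L * norm (s - t)"
    by (intro differentiable_bound[of UNIV]) auto
  then show ?thesis
    by (simp add: dist_norm)
qed

theorem lemma5p1:
  fixes X :: "real \<Rightarrow> real^2" and C\<^sub>1 C\<^sub>2 :: real
  assumes "param_closed_simple_curve X"
    and "circle_C2 X"
    and "0 < C\<^sub>1" and "C\<^sub>1 < C\<^sub>2"
    and "\<And>\<xi>. C\<^sub>1 \<le> norm (vector_derivative X (at \<xi>)) \<and> norm (vector_derivative X (at \<xi>)) \<le> C\<^sub>2"
  shows "\<exists>\<delta>\<^sub>0 > 0. \<exists>C > 0. \<forall>Y :: real \<Rightarrow> real^2.
           param_closed_simple_curve Y \<longrightarrow>
           Linf_norm (\<lambda>\<xi>. X \<xi> - Y \<xi>) \<le> ereal \<delta>\<^sub>0 \<longrightarrow>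
           ereal (manifold_distance (curve_image X) (curve_image Y))
             \<le> ereal C * Linf_norm (\<lambda>\<xi>. X \<xi> - Y \<xi>)"
proof -
  have lip: "dist (X s) (X t) \<le> C\<^sub>2 * \<bar>s - t\<bar>" for s t
    using assms(2,5) by (intro C1_lipschitz) (auto simp: circle_C2_def)
  \<comment> \<open>This is the tube bound with length \<open>2 * pi\<close> and Lipschitz constant
    \<open>C\<^sub>2\<close>, divided by \<open>e\<close>, after estimating the remaining
    \<open>e\<close> by the choice 1 for \<open>\<delta>\<^sub>0\<close>.\<close>
  define C where "C = 4 * pi * (2 * pi * C\<^sub>2 + 1)"
  have "0 < C"
    unfolding C_def using assms by (intro mult_pos_pos add_pos_pos) auto
  have "ereal (manifold_distance (curve_image X) (curve_image Y))
          \<le> ereal C * Linf_norm (\<lambda>\<xi>. X \<xi> - Y \<xi>)"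
    if Y: "param_closed_simple_curve Y" and le1: "Linf_norm (\<lambda>\<xi>. X \<xi> - Y \<xi>) \<le> ereal 1" for Y
  proof -
    have contX: "continuous_on UNIV X" and contY: "continuous_on UNIV Y"
      using assms(1) Y by (auto simp: param_closed_simple_curve_def circle_C0_def)
    have cont: "continuous_on UNIV (\<lambda>\<xi>. X \<xi> - Y \<xi>)"
      using contX contY by (intro continuous_intros)
    note le_Linf = norm_le_Linf_norm[OF cont]
    have "0 \<le> Linf_norm (\<lambda>\<xi>. X \<xi> - Y \<xi>)"
      using le_Linf[of 0] by (auto intro: order_trans[rotated])
    \<comment> \<open>Bounds on both sides make the extended-real norm a finite real number.\<close>
    with le1 obtain e where e: "Linf_norm (\<lambda>\<xi>. X \<xi> - Y \<xi>) = ereal e" "0 \<le> e" "e \<le> 1"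
      by (cases "Linf_norm (\<lambda>\<xi>. X \<xi> - Y \<xi>)") auto
    have close: "norm (X \<xi> - Y \<xi>) \<le> e" if "\<xi> \<in> {0..2*pi}" for \<xi>
      using le_Linf[OF that] e by simp
    have "manifold_distance (curve_image X) (curve_image Y) \<le> C * e"
    \<comment> \<open>The covering divides by \<open>e\<close>, so the case of coinciding curves is
      separate.\<close>
    proof (cases "e = 0")
      case True
      then have "curve_image X = curve_image Y"
        using close by (auto simp: curve_image_def intro!: image_cong)
      then show ?thesis
        using True by (simp add: manifold_distance_def)
    next
      case False
      with e have "0 < e" by simp
      \<comment> \<open>The region enclosed by a compact curve is open, hence measurable, as the
        area estimate requires.\<close>
      have "inside (curve_image Z) \<in> sets lebesgue"
        if "continuous_on UNIV Z" for Z :: "real \<Rightarrow> real^2"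
      proof -
        have "compact (curve_image Z)"
          unfolding curve_image_def using that
          by (intro compact_continuous_image) (auto intro: continuous_on_subset)
        then have "open (inside (curve_image Z))"
          by (intro open_inside compact_imp_closed)
        then show ?thesis
          by (simp add: sets_completionI_sets)
      qed
      then have sets: "inside (curve_image X) - inside (curve_image Y)
          \<union> (inside (curve_image Y) - inside (curve_image X)) \<in> sets lebesgue"
        using contX contY by (intro sets.Un sets.Diff)
      have "manifold_distance (curve_image X) (curve_image Y)
          \<le> 4 * pi * e * (2 * pi * C\<^sub>2 + e)"
        unfolding manifold_distance_def
      proof (rule measure_lipschitz_tube_le[OF _ \<open>0 < e\<close> _ lip sets])
        show "inside (curve_image X) - inside (curve_image Y)
            \<union> (inside (curve_image Y) - inside (curve_image X)) \<subseteq> (\<Union>\<xi>\<in>{0..2*pi}. cball (X \<xi>) e)"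
          using assms(1) Y close by (rule symmetric_difference_subset_neighbourhood)
      qed (use assms(3,4) in auto)
      also have "\<dots> \<le> 4 * pi * e * (2 * pi * C\<^sub>2 + 1)"
        using e by (intro mult_left_mono) auto
      finally show ?thesis
        by (simp add: C_def mult_ac)
    qed
    then show ?thesis
      using e by simp
  qed
  then show ?thesis
    using \<open>0 < C\<close> zero_less_one by blast
qed

end
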